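(* Let $\alpha\in(0,1)$. If $m>1$, then BY+ uniformly improves BY; that is: (1) for every vector of $p$-values $(p_1,\dots,p_m)\in[0,1]^m$, the set rejected by BY belongs to the collection of sets rejected by BY+; and (2) there is a vector of $p$-values $(p_1,\dots,p_m)\in[0,1]^m$ for which some set $R$ in the collection rejected by BY+ is a strict superset of the set rejected by BY.
   Context: Setting: $\mathbf{p}_1,\dots,\mathbf{p}_m$ are $p$-values for hypotheses $H_1,\dots,H_m$, with no assumption on their joint distribution. $[m]=\{1,\dots,m\}$, $\mathcal{M}=2^{[m]}\setminus\{\emptyset\}$, $a\vee b=\max(a,b)$, and $h_k=\sum_{i=1}^k 1/i$ is the $k$th harmonic number. Both procedures below are functions of the realized vector $(p_1,\dots,p_m)\in[0,1]^m$. BY at level $\alpha$: let $p_{(1)}\le\dots\le p_{(m)}$ be the sorted $p$-values and $r_\alpha=\max\{1\le r\le m: m h_m p_{(r)}\le r\alpha\}$, or $r_\alpha=0$ if no such $r$ exists. BY rejects the set of indices of the $r_\alpha$ smallest $p$-values, i.e. $R_\alpha=\{i:p_i\le p_{(r_\alpha)}\}$ if $r_\alpha\ge1$ and $R_\alpha=\emptyset$ if $r_\alpha=0$. BY+ at level $\alpha$: for $S\in\mathcal{M}$ define $$e_S=\sum_{i\in S}\frac{1\{h_{|S|}p_i\le\alpha\}}{\alpha\,\lceil |S|h_{|S|}p_i/\alpha\rceil}\in[0,\infty],$$ with the convention $1/0=\infty$ (relevant only when $p_i=0$). BY+ rejects the collection of sets $$\Big\{R\in2^{[m]}:\ \alpha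 e_S\ge\frac{|R\cap S|}{|R|\vee1}\ \text{for all }S\in\mathcal{M}\Big\}.$$ Uniform improvement (defined for procedures that control the false discovery rate at level $\alpha$, as both of these do): a collection-valued procedure $\boldsymbol{\mathcal{R}}$ uniformly improves a set-valued procedure $\mathbf{S}$ if (1) $\mathbf{S}\in\boldsymbol{\mathcal{R}}$ always, and (2) there is an event (here: a possible realization of the $p$-values) on which $\mathbf{S}\subsetneq R$ for some $R\in\boldsymbol{\mathcal{R}}$. *)

theory Defs
  imports "HOL-Analysis.Harmonic_Numbers" "HOL-Library.Extended_Nonnegative_Real" "HOL-Library.FuncSet"
begin

text \<open>A vector of \<open>p\<close>-values is a function on the index set \<open>{1..m}\<close>; a (set-valued) procedure
  maps such a vector to a set of rejected indices, a collection-valued one to a set of such sets.\<close>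

definition pvectors :: "nat \<Rightarrow> (nat \<Rightarrow> real) set" where
  "pvectors m = {1..m} \<rightarrow>\<^sub>E {0..1}"

text \<open>The \<open>r\<close>-th smallest entry, counted from \<open>r = 1\<close>; meaningful for \<open>1 \<le> r \<le> m\<close>.\<close>

definition order_stat :: "nat \<Rightarrow> (nat \<Rightarrow> real) \<Rightarrow> nat \<Rightarrow> real" where
  "order_stat m p r = sort (map p [1..<Suc m]) ! (r - 1)"

definition BY_ranks :: "nat \<Rightarrow> real \<Rightarrow> (nat \<Rightarrow> real) \<Rightarrow> nat set" where
  "BY_ranks m \<alpha> p = {r \<in> {1..m}. real m * harm m * order_stat m p r \<le> real r * \<alpha>}"

definition BY_rank :: "nat \<Rightarrow> real \<Rightarrow> (nat \<Rightarrow> real) \<Rightarrow> nat" where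
  "BY_rank m \<alpha> p = (if BY_ranks m \<alpha> p = {} then 0 else Max (BY_ranks m \<alpha> p))"

definition BY :: "nat \<Rightarrow> real \<Rightarrow> (nat \<Rightarrow> real) \<Rightarrow> nat set" where
  "BY m \<alpha> p =
    (if BY_rank m \<alpha> p \<ge> 1 then {i \<in> {1..m}. p i \<le> order_stat m p (BY_rank m \<alpha> p)} else {})"

text \<open>The division is that of \<^typ>\<open>ennreal\<close>, where \<open>1 / 0 = \<infinity>\<close> and \<open>0 / x = 0\<close>. For \<open>\<alpha> > 0\<close> the
  denominator vanishes only if \<open>p i = 0\<close>, in which case the indicator is 1.\<close>

definition BY_evalue :: "real \<Rightarrow> (nat \<Rightarrow> real) \<Rightarrow> nat set \<Rightarrow> ennreal" where
  "BY_evalue \<alpha> p S =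
    (\<Sum>i\<in>S. of_bool (harm (card S) * p i \<le> \<alpha>) /
       ennreal (\<alpha> * of_int \<lceil>real (card S) * harm (card S) * p i / \<alpha>\<rceil>))"

definition BY_plus :: "nat \<Rightarrow> real \<Rightarrow> (nat \<Rightarrow> real) \<Rightarrow> nat set set" where
  "BY_plus m \<alpha> p =
    {R \<in> Pow {1..m}. \<forall>S \<in> Pow {1..m} - {{}}.
       ennreal \<alpha> * BY_evalue \<alpha> p S \<ge> ennreal (real (card (R \<inter> S)) / real (max (card R) 1))}"

definition uniformly_improves ::
  "nat \<Rightarrow> ((nat \<Rightarrow> real) \<Rightarrow> nat set set) \<Rightarrow> ((nat \<Rightarrow> real) \<Rightarrow> nat set) \<Rightarrow> bool" where
  "uniformly_improves m \<R> \<S> \<longleftrightarrow>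
    (\<forall>p \<in> pvectors m. \<S> p \<in> \<R> p) \<and> (\<exists>p \<in> pvectors m. \<exists>R \<in> \<R> p. \<S> p \<subset> R)"

end

theory Submission
  imports Defs
begin

text \<open>If \<open>R\<close> is the BY set, then \<open>m h\<^sub>m p\<^sub>i \<le> |R| \<alpha>\<close> for all \<open>i \<in> R\<close>. For every \<open>S\<close>, each
  \<open>i \<in> R \<inter> S\<close> therefore has the ceiling in \<open>e\<^sub>S\<close> at most \<open>|R|\<close> and contributes at least
  \<open>1 / |R|\<close> to \<open>\<alpha> e\<^sub>S\<close>, which is exactly what BY+ asks for. For strictness take
  \<open>p\<^sub>m = \<alpha>\<close> and all other \<open>p\<^sub>i = 0\<close>: BY does not reject \<open>m\<close>, as \<open>h\<^sub>m > 1\<close>, but BY+ rejects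
  everything, since \<open>e\<^sub>S = \<infinity>\<close> unless \<open>S = {m}\<close>, and \<open>\<alpha> e\<^bsub>{m}\<^esub> = 1\<close>.\<close>

text \<open>The first \<open>r\<close> sorted entries are all at most the \<open>r\<close>-th. Ties
  with that value can add further indices, so only an inequality holds. It serves to bound the size
  of the BY set from below by its rank.\<close>

lemma card_le_order_stat:
  assumes "1 \<le> r" "r \<le> m"
  shows "r \<le> card {i \<in> {1..m}. p i \<le> order_stat m p r}"
proof -
  define xs where "xs = sort (map p [1..<Suc m])"
  define P where "P = (\<lambda>x. x \<le> order_stat m p r)"
  have len: "length xs = m"
    by (simp add: xs_def)
  have sorted: "sorted xs"
    by (simp add: xs_def)
  have all: "\<forall>x \<in> set (take r xs). P x"
  proof
    fix x assume "x \<in> set (take r xs)"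
    then obtain j where j: "j < r" "x = xs ! j"
      using assms len by (auto simp: in_set_conv_nth)
    then have "xs ! j \<le> xs ! (r - 1)"
      using assms len sorted by (intro sorted_nth_mono) auto
    then show "P x"
      by (simp add: P_def order_stat_def xs_def j)
  qed
  have "r = length (filter P (take r xs))"
    using all assms len by (simp add: filter_id_conv[THEN iffD2])
  also have "\<dots> \<le> length (filter P (take r xs @ drop r xs))"
    unfolding filter_append length_append by simp
  \<comment> \<open>Filtering commutes with sorting, so the count passes from the sorted list to the
    unsorted one, and from there to indices.\<close>
  also have "\<dots> = length (filter P (map p [1..<Suc m]))"
    by (simp add: xs_def filter_sort del: upt_Suc)
  also have "\<dots> = length (filter (P \<circ> p) [1..<Suc m])"
    by (simp add: filter_map del: upt_Suc)
  also have "\<dots> = card (set (filter (P \<circ> p) [1..<Suc m]))"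
    by (intro distinct_card[symmetric] distinct_filter distinct_upt)
  also have "set (filter (P \<circ> p) [1..<Suc m]) = {i \<in> {1..m}. p i \<le> order_stat m p r}"
    by (auto simp: P_def)
  finally show ?thesis .
qed

lemma BY_rank_mem_ranks:
  assumes "BY_rank m \<alpha> p \<ge> 1"
  shows "BY_rank m \<alpha> p \<in> BY_ranks m \<alpha> p"
proof -
  \<comment> \<open>Without admissible ranks \<open>BY_rank\<close> would take its default 0,
    against the assumption.\<close>
  have "BY_ranks m \<alpha> p \<noteq> {}"
    using assms by (auto simp: BY_rank_def split: if_splits)
  moreover have "finite (BY_ranks m \<alpha> p)"
    by (auto simp: BY_ranks_def)
  ultimately show ?thesis
    by (simp add: BY_rank_def)
qed

lemma BY_subset: "BY m \<alpha> p \<subseteq> {1..m}"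
  by (auto simp: BY_def)

text \<open>The witness is \<open>BY_rank\<close>. The bound by the number of rejections yields
  membership in BY+, the bound by \<open>m\<close> yields strictness.\<close>

lemma BY_mem_rank_bound:
  assumes "i \<in> BY m \<alpha> p"
  obtains r where "r \<le> m" "r \<le> card (BY m \<alpha> p)"
    "real m * harm m * p i \<le> real r * \<alpha>"
proof
  let ?r = "BY_rank m \<alpha> p"
  have r: "?r \<ge> 1" and i: "p i \<le> order_stat m p ?r"
    using assms by (auto simp: BY_def split: if_splits)
  have ranks: "?r \<in> BY_ranks m \<alpha> p"
    by (rule BY_rank_mem_ranks[OF r])
  show "?r \<le> m"
    using ranks by (simp add: BY_ranks_def)
  then show "?r \<le> card (BY m \<alpha> p)"
    using card_le_order_stat[OF r, of m p] r by (simp add: BY_def)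
  have "real m * harm m * p i \<le> real m * harm m * order_stat m p ?r"
    using i by (intro mult_left_mono) (auto simp: harm_nonneg)
  also have "\<dots> \<le> real ?r * \<alpha>"
    using ranks by (simp add: BY_ranks_def)
  finally show "real m * harm m * p i \<le> real ?r * \<alpha>" .
qed

lemma harm_le_harm:
  assumes "k \<le> m"
  shows "harm k \<le> (harm m :: real)"
  unfolding harm_def using assms by (intro sum_mono2) auto

text \<open>Here \<open>c\<close> stands for the ceiling in a summand of the e-value. If it is 0,
  the right side is infinite; otherwise 0 < c \<le> r and \<alpha> cancels.\<close>

lemma evalue_term_ge:
  assumes "0 < \<alpha>" "0 \<le> c" "c \<le> int r"
  shows "ennreal (1 / real r) \<le> ennreal \<alpha> * (1 / ennreal (\<alpha> * of_int c))"
proof (cases "c = 0")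
  case True
  then show ?thesis
    using assms by (simp add: ennreal_mult_top)
next
  case False
  then have c: "0 < c" using assms by simp
  have "1 / real r \<le> 1 / of_int c"
    using assms c by (intro divide_left_mono) auto
  also have "\<dots> = \<alpha> * (1 / (\<alpha> * of_int c))"
    using assms by simp
  finally have "ennreal (1 / real r) \<le> ennreal (\<alpha> * (1 / (\<alpha> * of_int c)))"
    by (rule ennreal_leI)
  also have "\<dots> = ennreal \<alpha> * ennreal (1 / (\<alpha> * of_int c))"
    using assms by (intro ennreal_mult) auto
  also have "ennreal (1 / (\<alpha> * of_int c)) = 1 / ennreal (\<alpha> * of_int c)"
    using assms c divide_ennreal[of 1 "\<alpha> * of_int c"] by simp
  finally show ?thesis .
qed

text \<open>All that matters about \<open>R\<close> is that its p-values are small relative to its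
  own size. For empty \<open>R\<close> the left side is 0 / 0 = 0.\<close>

lemma BY_evalue_ge:
  assumes "0 < \<alpha>" and p: "p \<in> pvectors m" and S: "S \<subseteq> {1..m}"
    and R: "R \<subseteq> {1..m}" "\<And>i. i \<in> R \<Longrightarrow> real m * harm m * p i \<le> real (card R) * \<alpha>"
  shows "ennreal (real (card (R \<inter> S)) / real (card R)) \<le> ennreal \<alpha> * BY_evalue \<alpha> p S"
proof -
  let ?s = "card S"
  let ?c = "\<lambda>i. \<lceil>real ?s * harm ?s * p i / \<alpha>\<rceil>"
  let ?t = "\<lambda>i. of_bool (harm ?s * p i \<le> \<alpha>) / ennreal (\<alpha> * of_int (?c i))"
  have fin: "finite S"
    using S finite_subset by blast
  have s: "?s \<le> m" "card R \<le> m"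
    using card_mono[OF _ S] card_mono[OF _ R(1)] by simp_all
  have bound: "ennreal (1 / real (card R)) \<le> ennreal \<alpha> * ?t i" if i: "i \<in> R \<inter> S" for i
  proof -
    have m: "real m > 0"
      using i R(1) by force
    have pi: "0 \<le> p i"
      using i S p by (auto simp: pvectors_def PiE_iff)
    have h: "harm ?s * p i \<le> harm m * p i"
      by (rule mult_right_mono[OF harm_le_harm[OF s(1)] pi])
    have "real m * (harm m * p i) \<le> real (card R) * \<alpha>"
      using R(2)[of i] i by (simp add: mult.assoc)
    \<comment> \<open>Since |R| \<le> m, the factor \<open>m\<close> cancels; this makes the
      indicator equal to 1.\<close>
    also have "\<dots> \<le> real m * \<alpha>"
      using s assms(1) by (intro mult_right_mono) auto
    finally have "harm m * p i \<le> \<alpha>"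
      using m by simp
    with h have ind: "harm ?s * p i \<le> \<alpha>"
      by simp
    \<comment> \<open>As k h_k grows with k, the bound at \<open>m\<close> passes to |S| and caps
      the ceiling by |R|.\<close>
    have "real ?s * (harm ?s * p i) \<le> real m * (harm m * p i)"
      using s pi by (intro mult_mono[OF _ h]) (auto simp: harm_nonneg)
    also have "\<dots> \<le> real (card R) * \<alpha>"
      using R(2)[of i] i by (simp add: mult.assoc)
    finally have "real ?s * harm ?s * p i / \<alpha> \<le> real (card R)"
      using assms(1) by (simp add: divide_le_eq mult.assoc)
    then have le: "?c i \<le> int (card R)"
      by (simp add: ceiling_le_iff)
    have "0 \<le> real ?s * harm ?s * p i / \<alpha>"
      using pi assms(1) by (simp add: harm_nonneg)
    then have "0 \<le> ?c i"
      by (subst zero_le_ceiling) linarith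
    with le ind show ?thesis
      using evalue_term_ge[OF assms(1), of "?c i" "card R"] by simp
  qed
  have "ennreal (real (card (R \<inter> S)) / real (card R)) = (\<Sum>i\<in>R \<inter> S. ennreal (1 / real (card R)))"
    by (simp add: ennreal_of_nat_eq_real_of_nat flip: ennreal_mult)
  also have "\<dots> \<le> (\<Sum>i\<in>R \<inter> S. ennreal \<alpha> * ?t i)"
    by (intro sum_mono bound)
  also have "\<dots> \<le> (\<Sum>i\<in>S. ennreal \<alpha> * ?t i)"
    using fin by (intro sum_mono2) auto
  also have "\<dots> = ennreal \<alpha> * BY_evalue \<alpha> p S"
    by (simp add: BY_evalue_def sum_distrib_left)
  finally show ?thesis .
qed

lemma BY_in_BY_plus:
  assumes "0 < \<alpha>" "p \<in> pvectors m"
  shows "BY m \<alpha> p \<in> BY_plus m \<alpha> p"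
proof (cases "BY m \<alpha> p = {}")
  case True
  then show ?thesis
    by (simp add: BY_plus_def)
next
  case False
  let ?R = "BY m \<alpha> p"
  have "card ?R > 0"
    using False BY_subset[of m \<alpha> p] by (simp add: card_gt_0_iff finite_subset)
  then have max: "max (card ?R) (Suc 0) = card ?R"
    by simp
  have "real m * harm m * p i \<le> real (card ?R) * \<alpha>" if i: "i \<in> ?R" for i
  proof -
    obtain r where r: "r \<le> card ?R" "real m * harm m * p i \<le> real r * \<alpha>"
      using BY_mem_rank_bound[OF i] .
    have "real r * \<alpha> \<le> real (card ?R) * \<alpha>"
      using r(1) assms(1) by (intro mult_right_mono) auto
    with r(2) show ?thesis by simp
  qed
  then have "ennreal (real (card (?R \<inter> S)) / real (card ?R)) \<le> ennreal \<alpha> * BY_evalue \<alpha> p S"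
    if "S \<subseteq> {1..m}" for S
    by (intro BY_evalue_ge[OF assms that BY_subset])
  then show ?thesis
    using BY_subset[of m \<alpha> p] by (simp add: BY_plus_def max)
qed

text \<open>The summand at \<open>i\<close> is 1 / 0: the indicator condition reads 0 \<le> \<alpha>
  and the ceiling vanishes.\<close>

lemma BY_evalue_infinite:
  assumes "0 < \<alpha>" "finite S" "i \<in> S" "p i = 0"
  shows "BY_evalue \<alpha> p S = \<infinity>"
  unfolding BY_evalue_def using assms by (auto intro!: bexI[of _ i])

lemma harm_gt_1:
  assumes "m > 1"
  shows "harm m > (1 :: real)"
  \<comment> \<open>Already h_2 = 3/2.\<close>
  using harm_le_harm[of 2 m] assms by (simp add: harm_expand)

theorem theorem3:
  fixes m :: nat and \<alpha> :: real
  assumes "0 < \<alpha>" and "\<alpha> < 1" and "m > 1"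
  shows "uniformly_improves m (BY_plus m \<alpha>) (BY m \<alpha>)"
proof -
  \<comment> \<open>Any value of \<open>p m\<close> in the interval (\<alpha> / h_m, \<alpha>] would
    do: above the largest BY threshold, yet with indicator and ceiling 1 for S = {m}.\<close>
  define p where "p = (\<lambda>i \<in> {1..m}. if i = m then \<alpha> else 0)"
  have p: "p \<in> pvectors m"
    using assms by (auto simp: p_def pvectors_def)
  have pm: "p m = \<alpha>"
    using assms by (simp add: p_def)
  have "m \<notin> BY m \<alpha> p"
  proof
    assume "m \<in> BY m \<alpha> p"
    then obtain r where "r \<le> m" "real m * harm m * p m \<le> real r * \<alpha>"
      by (rule BY_mem_rank_bound)
    moreover from this have "real r * \<alpha> \<le> real m * \<alpha>"
      using assms by (intro mult_right_mono) auto
    ultimately have "real m * \<alpha> * harm m \<le> real m * \<alpha> * 1"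
      by (simp add: pm mult_ac)
    then show False
      using harm_gt_1[OF assms(3)] assms by simp
  qed
  then have strict: "BY m \<alpha> p \<subset> {1..m}"
    using BY_subset[of m \<alpha> p] assms(3) by fastforce
  have "ennreal (real (card ({1..m} \<inter> S)) / real (max (card {1..m}) 1)) \<le>
      ennreal \<alpha> * BY_evalue \<alpha> p S" if S: "S \<subseteq> {1..m}" "S \<noteq> {}" for S
  proof (cases "S = {m}")
    case True
    \<comment> \<open>The ceiling is 1 because h_1 = 1 and \<open>p m\<close> = \<alpha>; the full
      set meets {m} in one of its \<open>m\<close> elements.\<close>
    have "ennreal (1 / real m) \<le> ennreal \<alpha> * (1 / ennreal (\<alpha> * of_int 1))"
      using assms by (intro evalue_term_ge) auto
    then show ?thesis
      using True assms by (simp add: BY_evalue_def pm harm_expand Int_absorb1)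
  next
    case False
    then obtain i where i: "i \<in> S" "i \<noteq> m"
      using S by blast
    then have "p i = 0"
      using S by (auto simp: p_def)
    then have "BY_evalue \<alpha> p S = \<infinity>"
      using BY_evalue_infinite[OF assms(1) _ i(1)] S finite_subset by blast
    then show ?thesis
      using assms by (simp add: ennreal_mult_top)
  qed
  then have "{1..m} \<in> BY_plus m \<alpha> p"
    by (simp add: BY_plus_def)
  with strict p show ?thesis
    unfolding uniformly_improves_def using BY_in_BY_plus[OF assms(1)] by blast
qed

end
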